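(* Let $K$ be a field, $E$ a non-empty set, and let $\{0\}\ne W\subset K^E$ be a finite-dimensional $K$-vector subspace. If $\#E<\#S(K)$, then $\mathcal T(W)\subset 2^E$ is a set of scrawls for $E$.
   Context: $\#$ denotes cardinality and $S(K)=K\cup\{K\}$ is the set-successor, so $\#S(K)=\#K+1$ if $K$ is finite and $\#S(K)=\#K$ if $K$ is infinite. For $v=(a_i)_{i\in E}\in K^E$ the support is $\mathcal T(v)=\{i\in E: a_i\ne0\}$, and $\mathcal T(W)=\{\mathcal T(v): v\in W\}$. A subset $\mathcal S\subset 2^E$ is a set of scrawls (of a matroid on $E$) if: (a) any union of elements of $\mathcal S$ is in $\mathcal S$; (b) whenever $X\subset C\in\mathcal S$ and $\{C_x: x\in X\}$ is a family of elements of $\mathcal S$ with $x\in C_y\iff x=y$ for all $x,y\in X$, then for every $z\in C\setminus\bigcup_xC_x$ there is $C'\in\mathcal S$ with $z\in C'\subset(C\cup\bigcup_xC_x)\setminus X$; (c) with $\mathcal I=\{I\subset E: C\not\subset I\ \forall C\in\mathcal S\setminus\{\emptyset\}\}$, whenever $I\subset X\subset E$ and $I\in\mathcal I$, the set $\{I'\in\mathcal I: I\subset I'\subset X\}$ has a maximal element with respect to inclusion. *)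

theory Defs
  imports
    Complex_Main
    "HOL-Library.Function_Algebras"
    "HOL-Library.Equipollence"
begin

text \<open>The group operations on functions are the pointwise ones of
  \<^theory>\<open>HOL-Library.Function_Algebras\<close>; together with the following scalar multiplication
  they make the functions into a vector space.\<close>

definition fun_scale :: "'k::field \<Rightarrow> ('e \<Rightarrow> 'k) \<Rightarrow> ('e \<Rightarrow> 'k)" where
  "fun_scale c v = (\<lambda>i. c * v i)"

global_interpretation fun_vs: vector_space "fun_scale :: 'k::field \<Rightarrow> ('e \<Rightarrow> 'k) \<Rightarrow> ('e \<Rightarrow> 'k)"
  defines fun_subspace = fun_vs.subspace
    and fun_span = fun_vs.span
  by unfold_locales (auto simp: fun_scale_def fun_eq_iff algebra_simps)

text \<open>The space \<open>K\<^sup>E\<close>, for \<open>K\<close> the type \<open>'k\<close> and \<open>E\<close> a set: a family indexed by \<open>E\<close> is encoded as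
  the function that extends it by \<open>0\<close> outside \<open>E\<close>. For \<open>E = UNIV\<close> these are all functions.\<close>

definition power_space :: "'e set \<Rightarrow> ('e \<Rightarrow> 'k::field) set" where
  "power_space E = {v. \<forall>i. i \<notin> E \<longrightarrow> v i = 0}"

definition finite_dimensional :: "('e \<Rightarrow> 'k::field) set \<Rightarrow> bool" where
  "finite_dimensional W \<longleftrightarrow> (\<exists>B. finite B \<and> fun_span B = W)"

definition supp :: "'e set \<Rightarrow> ('e \<Rightarrow> 'k::field) \<Rightarrow> 'e set" where
  "supp E v = {i \<in> E. v i \<noteq> 0}"

text \<open>The successor \<open>K \<union> {K}\<close>, up to bijection: \<open>K\<close> with one new element adjoined.\<close>

definition set_succ :: "'a set \<Rightarrow> 'a option set" where
  "set_succ K = insert None (Some ` K)"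

definition scrawl_indep :: "'e set \<Rightarrow> 'e set set \<Rightarrow> 'e set set" where
  "scrawl_indep E S = {I. I \<subseteq> E \<and> (\<forall>C \<in> S - {{}}. \<not> C \<subseteq> I)}"

text \<open>Unions of elements of \<open>S\<close> include the empty union, so \<open>{} \<in> S\<close>. In the second to last
  condition, \<open>D\<close> is the family of sets indexed by \<open>X\<close>; its values outside \<open>X\<close> are irrelevant.\<close>

definition scrawls :: "'e set \<Rightarrow> 'e set set \<Rightarrow> bool" where
  "scrawls E S \<longleftrightarrow>
     S \<subseteq> Pow E \<and>
     (\<forall>A. A \<subseteq> S \<longrightarrow> \<Union>A \<in> S) \<and>
     (\<forall>X C D. C \<in> S \<longrightarrow> X \<subseteq> C \<longrightarrow> (\<forall>x\<in>X. D x \<in> S) \<longrightarrow>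
        (\<forall>x\<in>X. \<forall>y\<in>X. x \<in> D y \<longleftrightarrow> x = y) \<longrightarrow>
        (\<forall>z \<in> C - (\<Union>x\<in>X. D x).
           \<exists>C'\<in>S. z \<in> C' \<and> C' \<subseteq> (C \<union> (\<Union>x\<in>X. D x)) - X)) \<and>
     (\<forall>I X. I \<in> scrawl_indep E S \<longrightarrow> I \<subseteq> X \<longrightarrow> X \<subseteq> E \<longrightarrow>
        (\<exists>M \<in> {I' \<in> scrawl_indep E S. I \<subseteq> I' \<and> I' \<subseteq> X}.
           \<forall>I' \<in> {I' \<in> scrawl_indep E S. I \<subseteq> I' \<and> I' \<subseteq> X}. M \<subseteq> I' \<longrightarrow> I' = M))"

end

theory Submission
  imports Defs
begin

text \<open>Two vectors \<open>v, w \<in> W\<close> have a combination whose support is the union of the two supports: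
  either \<open>w\<close> itself or some \<open>v + t w\<close> will do, since otherwise every \<open>t\<close>, and one extra point
  standing for \<open>w\<close>, would produce a coordinate of its own in \<open>E\<close>, that is, an injection of \<open>S(K)\<close>
  into \<open>E\<close>. By finite dimension, the union of the supports of any family of vectors is already
  the union of the supports of finitely many of its members, namely a basis of its span; so
  \<open>\<T>(W)\<close> is closed under all unions.

  The other two axioms rest on \<^emph>\<open>diagonal\<close> families: vectors \<open>w\<^sub>x \<in> W\<close>, for \<open>x \<in> X\<close>, such that for
  \<open>x, y \<in> X\<close> the coordinate of \<open>w\<^sub>y\<close> at \<open>x\<close> is nonzero exactly when \<open>x = y\<close>. Such a family is
  linearly independent, so \<open>X\<close> is finite, of cardinality at most the dimension of \<open>W\<close>. For the
  elimination axiom, the finite sum \<open>\<Sum>\<^sub>x (v\<^sub>x / w\<^sub>x\<^sub>x) w\<^sub>x\<close> is subtracted from \<open>v\<close>. For the existence of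
  maximal independent sets between \<open>I\<close> and \<open>X\<close>, choose \<open>J \<subseteq> X - I\<close> as large as possible among the
  sets that carry a diagonal family supported in \<open>X\<close>; then \<open>X - J\<close> is maximal independent.
  Indeed, a nonzero vector of \<open>W\<close> supported in \<open>X - J\<close> would extend the diagonal family, and adding
  some \<open>j \<in> J\<close> to \<open>X - J\<close> makes room for the support of \<open>w\<^sub>j\<close>.\<close>

section \<open>Supports\<close>

lemma mem_supp_iff: "i \<in> supp E v \<longleftrightarrow> i \<in> E \<and> v i \<noteq> 0"
  by (simp add: supp_def)

lemma supp_zero [simp]: "supp E 0 = {}"
  by (simp add: supp_def)

lemma supp_subset: "supp E v \<subseteq> E"
  by (auto simp: supp_def)

lemma supp_eq_empty_iff:
  assumes "v \<in> power_space E"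
  shows "supp E v = {} \<longleftrightarrow> v = 0"
  using assms by (auto simp: supp_def power_space_def fun_eq_iff)

lemma subspace_vanishing_at: "fun_subspace {v. v i = 0}"
  by (auto simp: fun_vs.subspace_def fun_scale_def)

lemma sum_fun_scale_apply: "(\<Sum>x\<in>X. fun_scale (c x) (w x)) i = (\<Sum>x\<in>X. c x * w x i)"
  by (induction X rule: infinite_finite_induct) (auto simp: fun_scale_def)

section \<open>Unions of supports\<close>

text \<open>The cardinality hypothesis enters the argument here. The alternative \<open>w\<close> next to the vectors
  \<open>v + t w\<close> plays the role of the point \<open>t = \<infinity>\<close>.\<close>

lemma supp_Un_realized:
  fixes v w :: "'e \<Rightarrow> 'k::field"
  assumes W: "fun_subspace W" "v \<in> W" "w \<in> W"
    and card: "E \<prec> set_succ (UNIV :: 'k set)"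
  shows "\<exists>u\<in>W. supp E u = supp E v \<union> supp E w"
proof (rule ccontr)
  assume no: "\<not> ?thesis"
  have bad: "\<exists>i\<in>E. (v i \<noteq> 0 \<or> w i \<noteq> 0) \<and> v i + t * w i = 0" for t
  proof -
    have "v + fun_scale t w \<in> W"
      using W by (simp add: fun_vs.subspace_add fun_vs.subspace_scale)
    with no have "supp E (v + fun_scale t w) \<noteq> supp E v \<union> supp E w" by blast
    then show ?thesis by (auto simp: supp_def fun_scale_def)
  qed
  then obtain f where f: "\<And>t. f t \<in> E"
      "\<And>t. v (f t) \<noteq> 0 \<or> w (f t) \<noteq> 0" "\<And>t. v (f t) + t * w (f t) = 0"
    by metis
  have wf: "w (f t) \<noteq> 0" for t using f(2,3)[of t] by auto
  have "supp E w \<noteq> supp E v \<union> supp E w" using no W(3) by blast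
  then obtain i0 where i0: "i0 \<in> E" "w i0 = 0" by (auto simp: supp_def)
  have inj: "f s = f t \<Longrightarrow> s = t" for s t
  proof -
    assume eq: "f s = f t"
    have "s * w (f t) = t * w (f t)"
      using f(3)[of s] f(3)[of t] eq by (metis add_left_cancel)
    then show "s = t" using wf[of t] by simp
  qed
  have "inj_on (case_option i0 f) (set_succ (UNIV :: 'k set))"
    using inj wf i0(2) by (auto simp: inj_on_def set_succ_def split: option.splits)
  moreover have "case_option i0 f ` set_succ (UNIV :: 'k set) \<subseteq> E"
    using i0 f(1) by (auto simp: set_succ_def)
  ultimately have "set_succ (UNIV :: 'k set) \<lesssim> E" by (auto simp: lepoll_def)
  with card show False by (auto simp: lesspoll_def dest: lepoll_antisym)
qed

lemma supp_finite_Union_realized: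
  fixes W :: "('e \<Rightarrow> 'k::field) set"
  assumes "fun_subspace W" "E \<prec> set_succ (UNIV :: 'k set)" "finite B" "B \<subseteq> W"
  shows "\<exists>u\<in>W. supp E u = (\<Union>b\<in>B. supp E b)"
  using assms(3,4)
proof (induction B rule: finite_induct)
  case empty
  then show ?case using assms(1) by (auto intro!: bexI[of _ 0] fun_vs.subspace_0)
next
  case (insert b B)
  then obtain u where "u \<in> W" "supp E u = (\<Union>b\<in>B. supp E b)" by auto
  then show ?case
    using supp_Un_realized[OF assms(1), of b u E] assms(2) insert.prems by auto
qed

lemma supp_span_subset:
  assumes "v \<in> fun_span B"
  shows "supp E v \<subseteq> (\<Union>b\<in>B. supp E b)"
proof
  fix i assume i: "i \<in> supp E v"
  show "i \<in> (\<Union>b\<in>B. supp E b)"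
  proof (rule ccontr)
    assume "\<not> ?thesis"
    then have "B \<subseteq> {v. v i = 0}" using i by (auto simp: supp_def)
    then have "fun_span B \<subseteq> {v. v i = 0}"
      by (rule fun_vs.span_minimal) (rule subspace_vanishing_at)
    with assms i show False by (auto simp: supp_def)
  qed
qed

lemma supp_Union_realized:
  fixes W :: "('e \<Rightarrow> 'k::field) set"
  assumes W: "fun_subspace W" "finite_dimensional W"
    and card: "E \<prec> set_succ (UNIV :: 'k set)" and V: "V \<subseteq> W"
  shows "\<exists>u\<in>W. supp E u = (\<Union>v\<in>V. supp E v)"
proof -
  obtain B where B: "B \<subseteq> V" "fun_vs.independent B" "V \<subseteq> fun_span B"
    using fun_vs.maximal_independent_subset by blast
  obtain B0 where "finite B0" "fun_span B0 = W"
    using W(2) by (auto simp: finite_dimensional_def)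
  then have "finite B"
    using fun_vs.independent_span_bound B(1,2) V by blast
  then obtain u where "u \<in> W" "supp E u = (\<Union>b\<in>B. supp E b)"
    using supp_finite_Union_realized[OF W(1) card, of B] B(1) V by auto
  moreover have "supp E v \<subseteq> (\<Union>b\<in>B. supp E b)" if "v \<in> V" for v
    using that B(3) by (intro supp_span_subset) auto
  then have "(\<Union>v\<in>V. supp E v) = (\<Union>b\<in>B. supp E b)"
    using B(1) by blast
  ultimately show ?thesis by auto
qed

section \<open>Diagonal families\<close>

text \<open>A family \<open>w\<close> of vectors, indexed by a set \<open>X\<close> of coordinates, whose matrix of entries at the
  coordinates in \<open>X\<close> is diagonal with nonzero diagonal entries; the values of \<open>w\<close> outside \<open>X\<close> are
  irrelevant.\<close>

definition diagonal_family :: "'e set \<Rightarrow> ('e \<Rightarrow> 'e \<Rightarrow> 'k::field) \<Rightarrow> bool" where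
  "diagonal_family X w \<longleftrightarrow> (\<forall>x\<in>X. \<forall>y\<in>X. w y x \<noteq> 0 \<longleftrightarrow> x = y)"

lemma diagonal_family_independent:
  assumes "diagonal_family X w"
  shows "inj_on w X" and "fun_vs.independent (w ` X)"
proof -
  show "inj_on w X"
    using assms by (auto simp: diagonal_family_def inj_on_def) metis
  show "fun_vs.independent (w ` X)"
  proof
    assume "fun_vs.dependent (w ` X)"
    then obtain x where x: "x \<in> X" "w x \<in> fun_span (w ` X - {w x})"
      by (auto simp: fun_vs.dependent_def)
    have "w ` X - {w x} \<subseteq> {v. v x = 0}"
      using assms x(1) by (auto simp: diagonal_family_def)
    then have "fun_span (w ` X - {w x}) \<subseteq> {v. v x = 0}"
      by (rule fun_vs.span_minimal) (rule subspace_vanishing_at)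
    with x assms show False by (auto simp: diagonal_family_def)
  qed
qed

lemma diagonal_family_bound:
  assumes "finite_dimensional W"
  obtains n where
    "\<And>X w. diagonal_family X w \<Longrightarrow> w ` X \<subseteq> W \<Longrightarrow> finite X \<and> card X \<le> n"
proof -
  obtain B where B: "finite B" "fun_span B = W"
    using assms by (auto simp: finite_dimensional_def)
  have "finite X \<and> card X \<le> card B" if "diagonal_family X w" "w ` X \<subseteq> W" for X w
    using fun_vs.independent_span_bound[of B "w ` X"] B that
      diagonal_family_independent[OF that(1)]
    by (auto simp: card_image dest: finite_imageD)
  then show ?thesis by (rule that)
qed

section \<open>Elimination\<close>

lemma diagonal_family_elimination:
  assumes W: "fun_subspace W" "finite_dimensional W"
    and w: "diagonal_family X w" "w ` X \<subseteq> W" and v: "v \<in> W"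
  obtains u where "u \<in> W" "\<And>x. x \<in> X \<Longrightarrow> u x = 0"
    "\<And>i. (\<And>x. x \<in> X \<Longrightarrow> w x i = 0) \<Longrightarrow> u i = v i"
proof -
  have X: "finite X" using diagonal_family_bound[OF W(2)] w by metis
  define u where "u = v - (\<Sum>x\<in>X. fun_scale (v x / w x x) (w x))"
  have u: "u i = v i - (\<Sum>x\<in>X. v x / w x x * w x i)" for i
    by (simp add: u_def sum_fun_scale_apply)
  show thesis
  proof
    show "u \<in> W"
      unfolding u_def using W v w(2)
      by (intro fun_vs.subspace_diff fun_vs.subspace_sum fun_vs.subspace_scale) auto
  next
    fix x assume x: "x \<in> X"
    have "(\<Sum>y\<in>X. v y / w y y * w y x) = (\<Sum>y\<in>X. if y = x then v x else 0)"
      using w(1) x by (intro sum.cong) (auto simp: diagonal_family_def)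
    then show "u x = 0" using X x by (simp add: u)
  next
    fix i assume "\<And>x. x \<in> X \<Longrightarrow> w x i = 0"
    then show "u i = v i" by (simp add: u)
  qed
qed

section \<open>Maximal independent sets\<close>

lemma scrawl_indep_supp_iff:
  assumes "W \<subseteq> power_space E"
  shows "I \<in> scrawl_indep E (supp E ` W) \<longleftrightarrow>
    I \<subseteq> E \<and> (\<forall>v\<in>W. supp E v \<subseteq> I \<longrightarrow> v = 0)"
proof -
  have "supp E v = {} \<longleftrightarrow> v = 0" if "v \<in> W" for v
    using that assms supp_eq_empty_iff by blast
  then show ?thesis by (auto simp: scrawl_indep_def)
qed

text \<open>A diagonal family grows by a vector \<open>v\<close> that vanishes on its index set: multiples of \<open>v\<close> clear
  the entries of the old vectors at a new coordinate \<open>j\<close>.\<close>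

lemma diagonal_family_insert:
  assumes V: "fun_subspace V" and w: "diagonal_family J w" "w ` J \<subseteq> V"
    and v: "v \<in> V" "\<And>x. x \<in> J \<Longrightarrow> v x = 0" "v j \<noteq> 0"
  shows "\<exists>w'. diagonal_family (insert j J) w' \<and> w' ` insert j J \<subseteq> V"
proof (intro exI conjI)
  let ?w' = "\<lambda>x. if x = j then v else w x - fun_scale (w x j / v j) v"
  show "diagonal_family (insert j J) ?w'"
    using w(1) v(2,3) by (auto simp: diagonal_family_def fun_scale_def)
  show "?w' ` insert j J \<subseteq> V"
    using V w(2) v(1) by (auto intro!: fun_vs.subspace_diff fun_vs.subspace_scale)
qed

lemma maximal_scrawl_indep_exists:
  assumes W: "W \<subseteq> power_space E" "fun_subspace W" "finite_dimensional W"
    and I: "I \<in> scrawl_indep E (supp E ` W)" "I \<subseteq> X" and X: "X \<subseteq> E"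
  obtains M where "M \<in> scrawl_indep E (supp E ` W)" "I \<subseteq> M" "M \<subseteq> X"
    "\<And>I'. I' \<in> scrawl_indep E (supp E ` W) \<Longrightarrow> M \<subseteq> I' \<Longrightarrow> I' \<subseteq> X \<Longrightarrow> I' = M"
proof -
  define V where "V = {v \<in> W. supp E v \<subseteq> X}"
  have "V = {v \<in> W. \<forall>i\<in>E - X. v i = 0}" by (auto simp: V_def supp_def)
  then have V: "fun_subspace V"
    using W(2) by (simp add: fun_vs.subspace_def fun_scale_def)
  define P where "P J \<longleftrightarrow> J \<subseteq> X - I \<and> (\<exists>w. diagonal_family J w \<and> w ` J \<subseteq> V)" for J
  obtain n where n: "\<And>X w. diagonal_family X w \<Longrightarrow> w ` X \<subseteq> W \<Longrightarrow> finite X \<and> card X \<le> n"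
    using diagonal_family_bound[OF W(3)] by metis
  have bound: "finite J \<and> card J \<le> n" if "P J" for J
    using that n unfolding P_def V_def by blast
  have "P {}" by (simp add: P_def diagonal_family_def)
  then obtain J where J: "P J" and max: "\<And>J'. P J' \<Longrightarrow> card J' \<le> card J"
    using ex_has_greatest_nat[of P "{}" card "Suc n"] bound by (metis less_Suc_eq_le)
  then obtain w where JX: "J \<subseteq> X - I" and w: "diagonal_family J w" "w ` J \<subseteq> V"
    by (auto simp: P_def)
  show thesis
  proof
    have "v = 0" if v: "v \<in> W" "supp E v \<subseteq> X - J" for v
    proof (rule ccontr)
      assume "v \<noteq> 0"
      then obtain j where j: "j \<in> supp E v" "j \<notin> I"
        using I(1) v(1) by (auto simp: scrawl_indep_supp_iff[OF W(1)])
      have "v \<in> V" "v j \<noteq> 0" using v j by (auto simp: V_def supp_def)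
      moreover have "v x = 0" if "x \<in> J" for x
        using that v(2) JX X by (auto simp: supp_def)
      ultimately have "P (insert j J)"
        using diagonal_family_insert[OF V w, of v j] j v(2) JX by (auto simp: P_def)
      then have "card (insert j J) \<le> card J" by (rule max)
      moreover have "j \<notin> J" using j(1) v(2) by auto
      ultimately show False using bound[OF J] by simp
    qed
    then show "X - J \<in> scrawl_indep E (supp E ` W)"
      using X by (auto simp: scrawl_indep_supp_iff[OF W(1)])
    show "I \<subseteq> X - J" using I(2) JX by auto
    show "X - J \<subseteq> X" by auto
  next
    fix I' assume I': "I' \<in> scrawl_indep E (supp E ` W)" "X - J \<subseteq> I'" "I' \<subseteq> X"
    have "j \<notin> I'" if j: "j \<in> J" for j
    proof
      assume "j \<in> I'"
      \<comment> \<open>on \<open>J\<close>, \<open>w j\<close> is nonzero only at \<open>j\<close>, so its support lies in \<open>(X - J) \<union> {j} \<subseteq> I'\<close>\<close>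
      have "w j \<in> W" "supp E (w j) \<subseteq> X" using w(2) j by (auto simp: V_def)
      moreover have "w j j \<noteq> 0" "\<And>x. x \<in> J \<Longrightarrow> x \<noteq> j \<Longrightarrow> w j x = 0"
        using w(1) j by (auto simp: diagonal_family_def)
      ultimately have "supp E (w j) \<subseteq> I'"
        using \<open>j \<in> I'\<close> I'(2) by (auto simp: supp_def)
      then have "w j = 0"
        using I'(1) \<open>w j \<in> W\<close> by (auto simp: scrawl_indep_supp_iff[OF W(1)])
      with \<open>w j j \<noteq> 0\<close> show False by simp
    qed
    then show "I' = X - J" using I'(2,3) by auto
  qed
qed

section \<open>The scrawls of a subspace\<close>

theorem theorem3p5:
  fixes E :: "'e set" and W :: "('e \<Rightarrow> 'k::field) set"
  assumes "E \<noteq> {}"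
    and "W \<subseteq> power_space E"
    and "fun_subspace W"
    and "finite_dimensional W"
    and "W \<noteq> {0}"
    and "E \<prec> set_succ (UNIV :: 'k set)"
  shows "scrawls E (supp E ` W)"
  unfolding scrawls_def
proof (intro conjI allI impI ballI)
  show "supp E ` W \<subseteq> Pow E" using supp_subset by fast
next
  fix A assume A: "A \<subseteq> supp E ` W"
  then obtain V where "V \<subseteq> W" "A = supp E ` V" by (auto simp: subset_image_iff)
  then show "\<Union>A \<in> supp E ` W"
    using supp_Union_realized[OF assms(3,4,6), of V] by auto
next
  fix X C D z
  assume C: "C \<in> supp E ` W" and XC: "X \<subseteq> C" and D: "\<forall>x\<in>X. D x \<in> supp E ` W"
    and diag: "\<forall>x\<in>X. \<forall>y\<in>X. x \<in> D y \<longleftrightarrow> x = y" and z: "z \<in> C - (\<Union>x\<in>X. D x)"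
  obtain v where v: "v \<in> W" "C = supp E v" using C by auto
  have "\<forall>x\<in>X. \<exists>w. w \<in> W \<and> D x = supp E w" using D by blast
  then obtain w where w: "\<And>x. x \<in> X \<Longrightarrow> w x \<in> W \<and> D x = supp E (w x)" by metis
  have XE: "X \<subseteq> E" using XC v supp_subset by fast
  have "diagonal_family X w"
    unfolding diagonal_family_def using w diag XE by (metis mem_supp_iff subsetD)
  moreover have "w ` X \<subseteq> W" using w by auto
  ultimately obtain u where u: "u \<in> W" "\<And>x. x \<in> X \<Longrightarrow> u x = 0"
      "\<And>i. (\<And>x. x \<in> X \<Longrightarrow> w x i = 0) \<Longrightarrow> u i = v i"
    using diagonal_family_elimination[OF assms(3,4) _ _ v(1)] by metis
  have off: "u i = v i" if "i \<in> E" "i \<notin> (\<Union>x\<in>X. D x)" for i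
    using that w by (intro u(3)) (auto simp: mem_supp_iff)
  have "z \<in> supp E u"
    using z off[of z] by (auto simp: v(2) mem_supp_iff)
  moreover have "supp E u \<subseteq> (C \<union> (\<Union>x\<in>X. D x)) - X"
    using off u(2) by (fastforce simp: v(2) mem_supp_iff)
  ultimately show "\<exists>C'\<in>supp E ` W. z \<in> C' \<and> C' \<subseteq> (C \<union> (\<Union>x\<in>X. D x)) - X"
    using u(1) by blast
next
  fix I X
  assume "I \<in> scrawl_indep E (supp E ` W)" "I \<subseteq> X" "X \<subseteq> E"
  from maximal_scrawl_indep_exists[OF assms(2-4) this]
  obtain M where "M \<in> scrawl_indep E (supp E ` W)" "I \<subseteq> M" "M \<subseteq> X"
    "\<And>I'. I' \<in> scrawl_indep E (supp E ` W) \<Longrightarrow> M \<subseteq> I' \<Longrightarrow> I' \<subseteq> X \<Longrightarrow> I' = M"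
    by metis
  then show "\<exists>M\<in>{I' \<in> scrawl_indep E (supp E ` W). I \<subseteq> I' \<and> I' \<subseteq> X}.
      \<forall>I'\<in>{I' \<in> scrawl_indep E (supp E ` W). I \<subseteq> I' \<and> I' \<subseteq> X}. M \<subseteq> I' \<longrightarrow> I' = M"
    by (intro bexI[of _ M]) auto
qed

end
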